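(* There exists a finitely generated (discrete) group $G$ that does not satisfy the Generalized Burghelea Conjecture; that is, there exist a finitely generated group $G$ and an element $x\in G$ of infinite order such that $T_*(x;\mathbb{Q})\neq 0$ (i.e. $T_*(x;\mathbb{Q})\ne 0$ for some $*\in\{0,1\}$).
   Context: Let $G$ be a discrete group and $x\in G$ an element of infinite order. Let $G_x=\{g\in G: gx=xg\}$ be the centralizer of $x$ in $G$, and let $N_x=G_x/\langle x\rangle$ be the reduced centralizer. The central extension $1\to\langle x\rangle\to G_x\to N_x\to 1$ with $\langle x\rangle\cong\mathbb{Z}$ gives a fibration of classifying spaces $B\langle x\rangle\simeq S^1\to BG_x\to BN_x$. Its Gysin sequence in rational homology, $$\cdots\to H_{m+2}(G_x;\mathbb{Q})\to H_{m+2}(N_x;\mathbb{Q})\xrightarrow{\;S\;}H_m(N_x;\mathbb{Q})\to H_{m+1}(G_x;\mathbb{Q})\to\cdots,$$ provides the Gysin homomorphisms $S\colon H_{m+2}(N_x;\mathbb{Q})\to H_m(N_x;\mathbb{Q})$ (equivalently, up to sign, cap product with the image in $H^2(N_x;\mathbb{Q})$ of the class in $H^2(N_x;\mathbb{Z})$ of the central extension). For $*\in\{0,1\}$ define $$T_*(x;\mathbb{Q})=\varprojlim_n\, H_{*+2n}(N_x;\mathbb{Q}),$$ the inverse limit over $n\ge 0$ with the Gysin homomorphisms $S$ as bonding maps. Up to isomorphism it depends only on the conjugacy class of $x$. The Generalized Burghelea Conjecture for a discrete group $G$ is the assertion that $T_*(x;\mathbb{Q})=0$ for every $x\in G$ of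 infinite order (for both $*=0$ and $*=1$). *)

theory Defs
  imports "HOL-Algebra.Algebra" "HOL-Library.Poly_Mapping"
begin

section \<open>Rational group homology\<close>

text \<open>
  Homology with trivial rational coefficients is computed by the (unnormalised) bar complex:
  an \<open>n\<close>-chain is a finite rational combination of cells \<open>[g\<^sub>1|\<dots>|g\<^sub>n]\<close>, a cell being
  a list of length \<open>n\<close>.  The homology of this complex is that of the classifying space.
\<close>

definition bar_cells :: "('a, 'b) monoid_scheme \<Rightarrow> nat \<Rightarrow> 'a list set" where
  "bar_cells G n = {\<sigma>. length \<sigma> = n \<and> set \<sigma> \<subseteq> carrier G}"

definition bar_chains :: "('a, 'b) monoid_scheme \<Rightarrow> nat \<Rightarrow> ('a list \<Rightarrow>\<^sub>0 rat) set" where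
  "bar_chains G n = {c. Poly_Mapping.keys c \<subseteq> bar_cells G n}"

definition lin_extend :: "('k \<Rightarrow> ('l \<Rightarrow>\<^sub>0 rat)) \<Rightarrow> ('k \<Rightarrow>\<^sub>0 rat) \<Rightarrow> ('l \<Rightarrow>\<^sub>0 rat)" where
  "lin_extend \<phi> c =
     (\<Sum>\<sigma>\<in>Poly_Mapping.keys c. Poly_Mapping.map ((*) (Poly_Mapping.lookup c \<sigma>)) (\<phi> \<sigma>))"

definition bar_face :: "('a, 'b) monoid_scheme \<Rightarrow> nat \<Rightarrow> 'a list \<Rightarrow> 'a list" where
  "bar_face G i \<sigma> =
     (if i = 0 then tl \<sigma>
      else if i = length \<sigma> then butlast \<sigma>
      else take (i - 1) \<sigma> @ [\<sigma> ! (i - 1) \<otimes>\<^bsub>G\<^esub> \<sigma> ! i] @ drop (i + 1) \<sigma>)"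

definition bar_boundary :: "('a, 'b) monoid_scheme \<Rightarrow> ('a list \<Rightarrow>\<^sub>0 rat) \<Rightarrow> ('a list \<Rightarrow>\<^sub>0 rat)" where
  "bar_boundary G =
     lin_extend (\<lambda>\<sigma>. if \<sigma> = [] then 0
                     else (\<Sum>i\<le>length \<sigma>. Poly_Mapping.single (bar_face G i \<sigma>) ((- 1) ^ i)))"

definition bar_cycle_group :: "('a, 'b) monoid_scheme \<Rightarrow> nat \<Rightarrow> ('a list \<Rightarrow>\<^sub>0 rat) monoid" where
  "bar_cycle_group G n =
     \<lparr>carrier = {c \<in> bar_chains G n. bar_boundary G c = 0}, monoid.mult = (+), one = 0\<rparr>"

definition bar_boundaries :: "('a, 'b) monoid_scheme \<Rightarrow> nat \<Rightarrow> ('a list \<Rightarrow>\<^sub>0 rat) set" where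
  "bar_boundaries G n = bar_boundary G ` bar_chains G (Suc n)"

text \<open>
  The underlying (multiplicatively written) abelian group of \<open>H\<^sub>n(G; \<rat>)\<close>.
\<close>

definition rat_homology :: "('a, 'b) monoid_scheme \<Rightarrow> nat \<Rightarrow> ('a list \<Rightarrow>\<^sub>0 rat) set monoid" where
  "rat_homology G n = bar_cycle_group G n Mod bar_boundaries G n"


section \<open>The central extension attached to an element\<close>

definition centralizer_group :: "('a, 'b) monoid_scheme \<Rightarrow> 'a \<Rightarrow> ('a, 'b) monoid_scheme" where
  "centralizer_group G x = G\<lparr>carrier := {g \<in> carrier G. g \<otimes>\<^bsub>G\<^esub> x = x \<otimes>\<^bsub>G\<^esub> g}\<rparr>"

definition reduced_centralizer :: "('a, 'b) monoid_scheme \<Rightarrow> 'a \<Rightarrow> 'a set monoid" where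
  "reduced_centralizer G x =
     centralizer_group G x Mod generate (centralizer_group G x) {x}"

definition coset_section :: "'a set \<Rightarrow> 'a" where
  "coset_section A = (SOME a. a \<in> A)"

text \<open>
  The integral 2-cocycle \<open>f\<close> on the reduced centralizer with
  \<open>s A \<cdot> s B = x\<^bsup>f A B\<^esup> \<cdot> s (A B)\<close>, where \<open>s\<close> is the set-theoretic section above.
  It represents the class of the central extension by \<open>\<langle>x\<rangle> \<cong> \<int>\<close>; another section changes it
  by a coboundary only.  For \<open>x\<close> of infinite order the exponent is unique.
\<close>

definition extension_cocycle :: "('a, 'b) monoid_scheme \<Rightarrow> 'a \<Rightarrow> 'a set \<Rightarrow> 'a set \<Rightarrow> int" where
  "extension_cocycle G x A B =
     (THE k. coset_section A \<otimes>\<^bsub>G\<^esub> coset_section B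
             = (x [^]\<^bsub>G\<^esub> k) \<otimes>\<^bsub>G\<^esub> coset_section (A \<otimes>\<^bsub>reduced_centralizer G x\<^esub> B))"


section \<open>Gysin homomorphisms\<close>

text \<open>
  Cap product with a 2-cochain, evaluated on the front face:
  \<open>[g\<^sub>1|g\<^sub>2|g\<^sub>3|\<dots>|g\<^sub>n] \<mapsto> f g\<^sub>1 g\<^sub>2 \<cdot> [g\<^sub>3|\<dots>|g\<^sub>n]\<close>.
  With the boundary above, the cocycle identity makes this commute with the boundary without
  any sign.
\<close>

definition cap2 :: "('a \<Rightarrow> 'a \<Rightarrow> rat) \<Rightarrow> ('a list \<Rightarrow>\<^sub>0 rat) \<Rightarrow> ('a list \<Rightarrow>\<^sub>0 rat)" where
  "cap2 f = lin_extend (\<lambda>\<sigma>. case \<sigma> of a # b # \<tau> \<Rightarrow> Poly_Mapping.single \<tau> (f a b) | _ \<Rightarrow> 0)"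

text \<open>
  The Gysin homomorphism \<open>H\<^bsub>m+2\<^esub>(N; \<rat>) \<rightarrow> H\<^sub>m(N; \<rat>)\<close> of the circle fibration
  \<open>B\<langle>x\<rangle> \<rightarrow> BG\<^sub>x \<rightarrow> BN\<close>, \<open>N\<close> the reduced centralizer: the map induced on homology by cap
  product with the rational class of the central extension.  The sign convention is immaterial
  for the inverse limit below, up to isomorphism.  A homology class \<open>C\<close> is a coset of cycles;
  the union of the cosets of the images of its members is a single coset.
\<close>

definition gysin ::
  "('a, 'b) monoid_scheme \<Rightarrow> 'a \<Rightarrow> nat \<Rightarrow> ('a set list \<Rightarrow>\<^sub>0 rat) set \<Rightarrow> ('a set list \<Rightarrow>\<^sub>0 rat) set" where
  "gysin G x m C =
     (let N = reduced_centralizer G x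
      in \<Union>c\<in>C. bar_boundaries N m #>\<^bsub>bar_cycle_group N m\<^esub>
                 cap2 (\<lambda>A B. of_int (extension_cocycle G x A B)) c)"


section \<open>The Generalized Burghelea Conjecture\<close>

text \<open>
  \<open>T\<^sub>i(x; \<rat>)\<close>: the inverse limit of \<open>n \<mapsto> H\<^bsub>i+2n\<^esub>(N; \<rat>)\<close> along the Gysin homomorphisms,
  as a subgroup of the product.
\<close>

definition burghelea_T ::
  "('a, 'b) monoid_scheme \<Rightarrow> 'a \<Rightarrow> nat \<Rightarrow> (nat \<Rightarrow> ('a set list \<Rightarrow>\<^sub>0 rat) set) monoid" where
  "burghelea_T G x i =
     (let P = product_group UNIV (\<lambda>n. rat_homology (reduced_centralizer G x) (i + 2 * n))
      in P\<lparr>carrier := {h \<in> carrier P. \<forall>n. gysin G x (i + 2 * n) (h (Suc n)) = h n}\<rparr>)"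

definition infinite_order :: "('a, 'b) monoid_scheme \<Rightarrow> 'a \<Rightarrow> bool" where
  "infinite_order G x \<longleftrightarrow> (\<forall>n::nat. n \<noteq> 0 \<longrightarrow> x [^]\<^bsub>G\<^esub> n \<noteq> \<one>\<^bsub>G\<^esub>)"

definition generalized_burghelea_conjecture :: "('a, 'b) monoid_scheme \<Rightarrow> bool" where
  "generalized_burghelea_conjecture G \<longleftrightarrow>
     (\<forall>x\<in>carrier G. infinite_order G x \<longrightarrow>
        (\<forall>i\<in>{0, 1}. carrier (burghelea_T G x i) = {\<one>\<^bsub>burghelea_T G x i\<^esub>}))"

text \<open>
  A finitely generated group is countable, so up to isomorphism every such group has its carrier
  inside \<open>nat\<close>.
\<close>

definition finitely_generated_group :: "('a, 'b) monoid_scheme \<Rightarrow> bool" where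
  "finitely_generated_group G \<longleftrightarrow>
     group G \<and> (\<exists>S. finite S \<and> S \<subseteq> carrier G \<and> generate G S = carrier G)"

end

theory Submission
  imports Defs "HOL-Library.Countable_Set"
begin

text \<open>
  Let \<open>a\<^sub>0, b\<^sub>0, a\<^sub>1, b\<^sub>1, \<dots>\<close> be elements of a group that all commute, except that
  \<open>a\<^sub>i b\<^sub>i = x b\<^sub>i a\<^sub>i\<close> for one and the same element \<open>x\<close> of infinite order, which
  commutes with all of them: an infinite Heisenberg group.  In the reduced centralizer \<open>N\<close> of \<open>x\<close>
  their cosets \<open>\<alpha>\<^sub>i, \<beta>\<^sub>i\<close> commute, so any finitely many of them span tori with fundamental cycles
  in the bar complex of \<open>N\<close>.  On these cycles the Gysin homomorphism, the cap product with the
  class of the extension, is the contraction with the symplectic form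
  \<open>\<omega>(\<alpha>\<^sub>i, \<beta>\<^sub>j) = \<delta>\<^sub>i\<^sub>j\<close>, \<open>\<omega>(\<alpha>\<^sub>i, \<alpha>\<^sub>j) = \<omega>(\<beta>\<^sub>i, \<beta>\<^sub>j) = 0\<close>.  An exterior algebra of
  finite rank has bounded degree, but in infinite rank the contraction is surjective: the product
  with a torus \<open>\<alpha>\<^sub>m \<and> \<beta>\<^sub>m\<close> that is disjoint from a given cycle is a right inverse of the contraction
  up to an error that induction removes, since repeated contraction kills the cycle.  Hence the
  generator of \<open>H\<^sub>0(N; \<rat>) = \<rat>\<close> lifts through the whole inverse system, and \<open>T\<^sub>0(x; \<rat>) \<noteq> 0\<close>.

  The lifting works on the level of chains.  Inserting an element \<open>g\<close> with alternating signs in all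
  places of a bar cell anticommutes with the boundary on cells whose entries commute with \<open>g\<close>
  (\<open>bar_boundary_shuffle\<close>), and its commutator with the cap product involves only the
  antisymmetrization of the cocycle (\<open>cap2_shuffle\<close>, \<open>contract_shuffle\<close>).  For the cocycle of a
  central extension that antisymmetrization is the commutator pairing, whatever section defines the
  cocycle (\<open>cosets_of_commutator\<close>).  So there are cycles \<open>c\<^sub>n\<close> of degree \<open>2n\<close> such that the
  cap product maps \<open>c\<^bsub>n+1\<^esub>\<close> to \<open>c\<^sub>n\<close> exactly, with \<open>c\<^sub>0\<close> the empty cell (\<open>coherent_cycles\<close>);
  the empty cell is not a boundary because all boundaries in degree \<open>0\<close> vanish.

  Finite generation costs one more generator: let the indices run through the integers and add an
  element \<open>t\<close> that shifts them, as in a lamplighter group.  Then \<open>a\<^sub>0\<close>, \<open>b\<^sub>0\<close>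
  and \<open>t\<close> generate all \<open>a\<^sub>i\<close>, \<open>b\<^sub>i\<close> and \<open>x\<close>.
\<close>

section \<open>Linear extension\<close>

definition scale :: "rat \<Rightarrow> ('k \<Rightarrow>\<^sub>0 rat) \<Rightarrow> ('k \<Rightarrow>\<^sub>0 rat)" where
  "scale r c = Poly_Mapping.map ((*) r) c"

abbreviation word :: "'k \<Rightarrow> ('k \<Rightarrow>\<^sub>0 rat)" where
  "word \<sigma> \<equiv> Poly_Mapping.single \<sigma> 1"

lemma lookup_scale [simp]: "Poly_Mapping.lookup (scale r c) k = r * Poly_Mapping.lookup c k"
  by (simp add: scale_def map.rep_eq when_def)

lemma scale_simps [simp]:
  "scale r 0 = 0" "scale 0 c = 0" "scale 1 c = c" "scale (- 1) c = - c"
  "scale r (c + d) = scale r c + scale r d"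
  "scale r (c - d) = scale r c - scale r d"
  "scale r (- c) = - scale r c"
  "scale r (scale s c) = scale (r * s) c"
  by (rule poly_mapping_eqI; simp add: lookup_add lookup_minus algebra_simps lookup_single when_def)+

text \<open>
  All chains below are written as multiples of single words, so that rewriting never has to move
  coefficients into or out of a single cell.
\<close>
lemma single_eq_scale_word: "Poly_Mapping.single \<sigma> r = scale r (word \<sigma>)"
  by (rule poly_mapping_eqI) (simp add: lookup_single when_def)

lemma scale_left_distrib: "scale (r + s) c = scale r c + scale s c"
  by (rule poly_mapping_eqI) (simp add: lookup_add algebra_simps)

lemma scale_left_diff_distrib: "scale (r - s) c = scale r c - scale s c"
  by (rule poly_mapping_eqI) (simp add: lookup_minus algebra_simps)

lemma scale_sum: "scale r (sum f A) = (\<Sum>x\<in>A. scale r (f x))"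
  by (induction A rule: infinite_finite_induct) simp_all

lemma lin_extend_eq_sum:
  assumes "finite A" "Poly_Mapping.keys c \<subseteq> A"
  shows "lin_extend \<phi> c = (\<Sum>\<sigma>\<in>A. scale (Poly_Mapping.lookup c \<sigma>) (\<phi> \<sigma>))"
  unfolding lin_extend_def scale_def [symmetric] using assms
  by (intro sum.mono_neutral_left) (auto simp: in_keys_iff)

lemma lin_extend_add [simp]: "lin_extend \<phi> (c + d) = lin_extend \<phi> c + lin_extend \<phi> d"
proof -
  have "lin_extend \<phi> e = (\<Sum>\<sigma>\<in>Poly_Mapping.keys c \<union> Poly_Mapping.keys d. scale (Poly_Mapping.lookup e \<sigma>) (\<phi> \<sigma>))"
    if "e \<in> {c, d, c + d}" for e
    using that keys_add [of c d] by (intro lin_extend_eq_sum) auto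
  then show ?thesis
    by (simp add: lookup_add scale_left_distrib sum.distrib)
qed

lemma lin_extend_scale [simp]: "lin_extend \<phi> (scale r c) = scale r (lin_extend \<phi> c)"
proof -
  have "Poly_Mapping.keys (scale r c) \<subseteq> Poly_Mapping.keys c"
    by (auto simp: in_keys_iff)
  then show ?thesis
    by (simp add: lin_extend_eq_sum [of "Poly_Mapping.keys c"] scale_sum)
qed

lemma lin_extend_word [simp]: "lin_extend \<phi> (word \<sigma>) = \<phi> \<sigma>"
  by (simp add: lin_extend_eq_sum [of "{\<sigma>}"])

lemma lin_extend_zero [simp]: "lin_extend \<phi> 0 = 0"
  by (simp add: lin_extend_def)

lemma lin_extend_minus [simp]: "lin_extend \<phi> (- c) = - lin_extend \<phi> c"
  using lin_extend_scale [of \<phi> "- 1" c] by simp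

lemma lin_extend_diff [simp]: "lin_extend \<phi> (c - d) = lin_extend \<phi> c - lin_extend \<phi> d"
  using lin_extend_add [of \<phi> c "- d"] by simp

lemma lin_extend_sum: "lin_extend \<phi> (sum f A) = (\<Sum>x\<in>A. lin_extend \<phi> (f x))"
  by (induction A rule: infinite_finite_induct) simp_all

lemma keys_lin_extend: "Poly_Mapping.keys (lin_extend \<phi> c) \<subseteq> (\<Union>\<sigma>\<in>Poly_Mapping.keys c. Poly_Mapping.keys (\<phi> \<sigma>))"
proof
  fix \<tau> assume "\<tau> \<in> Poly_Mapping.keys (lin_extend \<phi> c)"
  then have "Poly_Mapping.lookup (lin_extend \<phi> c) \<tau> \<noteq> 0"
    by (simp add: in_keys_iff)
  then have "(\<Sum>\<sigma>\<in>Poly_Mapping.keys c. Poly_Mapping.lookup c \<sigma> * Poly_Mapping.lookup (\<phi> \<sigma>) \<tau>) \<noteq> 0"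
    unfolding lin_extend_eq_sum [OF finite_keys order_refl] lookup_sum lookup_scale .
  then obtain \<sigma> where "\<sigma> \<in> Poly_Mapping.keys c" "Poly_Mapping.lookup (\<phi> \<sigma>) \<tau> \<noteq> 0"
    by (auto elim!: sum.not_neutral_contains_not_neutral)
  then show "\<tau> \<in> (\<Union>\<sigma>\<in>Poly_Mapping.keys c. Poly_Mapping.keys (\<phi> \<sigma>))"
    by (auto simp: in_keys_iff)
qed

text \<open>
  Identities between linear maps are proved on single cells; the cases for sums and multiples make
  the linearity of both sides do the rest.
\<close>
lemma chain_induct [consumes 1, case_names zero add scale word]:
  assumes "Poly_Mapping.keys c \<subseteq> S"
    and zero: "P 0" and add: "\<And>c d. P c \<Longrightarrow> P d \<Longrightarrow> P (c + d)"
    and sc: "\<And>r c. P c \<Longrightarrow> P (scale r c)"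
    and word: "\<And>\<sigma>. \<sigma> \<in> S \<Longrightarrow> P (word \<sigma>)"
  shows "P c"
proof -
  have "c = lin_extend word c"
    unfolding lin_extend_eq_sum [OF finite_keys order_refl] single_eq_scale_word [symmetric]
    by (rule poly_mapping_eqI)
      (auto simp: lookup_sum lookup_single when_def sum.delta' not_in_keys_iff_lookup_eq_zero cong: if_cong)
  moreover have "P (\<Sum>\<sigma>\<in>A. scale (Poly_Mapping.lookup c \<sigma>) (word \<sigma>))" if "A \<subseteq> Poly_Mapping.keys c" for A
    using finite_subset [OF that finite_keys] that
  proof (induction A rule: finite_induct)
    case empty
    then show ?case using zero by simp
  next
    case (insert \<sigma> A)
    then show ?case
      using assms(1) by (subst sum.insert) (auto intro!: add sc word simp del: scale_simps)
  qed
  ultimately show ?thesis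
    by (metis lin_extend_eq_sum [OF finite_keys order_refl] order_refl)
qed

section \<open>The bar complex, one entry at a time\<close>

definition cells :: "'a set \<Rightarrow> nat \<Rightarrow> 'a list set" where
  "cells A n = {\<sigma>. length \<sigma> = n \<and> set \<sigma> \<subseteq> A}"

text \<open>
  Putting an entry in front of all cells turns the alternating sum of faces into a recursion
  on words.
\<close>
definition prepend :: "'a \<Rightarrow> ('a list \<Rightarrow>\<^sub>0 rat) \<Rightarrow> ('a list \<Rightarrow>\<^sub>0 rat)" where
  "prepend a = lin_extend (\<lambda>\<sigma>. word (a # \<sigma>))"

lemma prepend_simps [simp]:
  "prepend a 0 = 0" "prepend a (c + d) = prepend a c + prepend a d"
  "prepend a (c - d) = prepend a c - prepend a d" "prepend a (- c) = - prepend a c"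
  "prepend a (scale r c) = scale r (prepend a c)"
  by (simp_all add: prepend_def)

lemma word_Cons: "word (a # \<sigma>) = prepend a (word \<sigma>)"
  by (simp add: prepend_def)

lemma bar_boundary_simps [simp]:
  "bar_boundary G 0 = 0" "bar_boundary G (c + d) = bar_boundary G c + bar_boundary G d"
  "bar_boundary G (c - d) = bar_boundary G c - bar_boundary G d"
  "bar_boundary G (- c) = - bar_boundary G c"
  "bar_boundary G (scale r c) = scale r (bar_boundary G c)"
  by (simp_all add: bar_boundary_def)

lemma cap2_simps [simp]:
  "cap2 f 0 = 0" "cap2 f (c + d) = cap2 f c + cap2 f d"
  "cap2 f (c - d) = cap2 f c - cap2 f d" "cap2 f (- c) = - cap2 f c"
  "cap2 f (scale r c) = scale r (cap2 f c)"
  by (simp_all add: cap2_def)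

lemma cap2_short [simp]: "cap2 f (word []) = 0" "cap2 f (prepend a (word [])) = 0"
  by (simp_all add: cap2_def word_Cons [symmetric])

lemma cap2_prepend_prepend [simp]: "cap2 f (prepend a (prepend b c)) = scale (f a b) c"
  using subset_UNIV [of "Poly_Mapping.keys c"]
  by (induction c rule: chain_induct)
    (simp_all add: cap2_def word_Cons [symmetric] single_eq_scale_word [where r = "f a b"] mult.commute)

lemma bar_boundary_Nil [simp]: "bar_boundary G (word []) = 0"
  by (simp add: bar_boundary_def)

lemma bar_boundary_singleton [simp]: "bar_boundary G (prepend a (word [])) = 0"
  by (simp add: word_Cons [symmetric] bar_boundary_def bar_face_def atMost_Suc single_uminus)

lemma bar_face_Suc_Cons:
  assumes "0 < i" "i \<le> length \<sigma>"
  shows "bar_face G (Suc i) (a # \<sigma>) = a # bar_face G i \<sigma>"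
  using assms by (cases i) (auto simp: bar_face_def)

lemma bar_boundary_Cons_Cons:
  "bar_boundary G (word (a # b # \<tau>)) =
     word (b # \<tau>) - word ((a \<otimes>\<^bsub>G\<^esub> b) # \<tau>) + word (a # \<tau>)
     - prepend a (bar_boundary G (word (b # \<tau>)))"
proof -
  let ?n = "length \<tau>"
  have D: "bar_boundary G (word \<sigma>)
      = (\<Sum>i\<le>length \<sigma>. Poly_Mapping.single (bar_face G i \<sigma>) ((- 1) ^ i))" if "\<sigma> \<noteq> []" for \<sigma>
    using that by (simp add: bar_boundary_def)
  have p: "prepend a (sum f I) = (\<Sum>i\<in>I. prepend a (f i))" for f and I :: "nat set"
    by (simp add: prepend_def lin_extend_sum)
  have "(\<Sum>i\<le>?n. Poly_Mapping.single (bar_face G (Suc (Suc i)) (a # b # \<tau>)) ((- 1) ^ Suc (Suc i)))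
      = (\<Sum>i\<le>?n. - prepend a (Poly_Mapping.single (bar_face G (Suc i) (b # \<tau>)) ((- 1) ^ Suc i)))"
    by (intro sum.cong refl, subst bar_face_Suc_Cons) (auto simp: prepend_def single_uminus
        single_eq_scale_word [where r = "(- 1) ^ _"])
  then show ?thesis
    by (simp add: D sum.atMost_Suc_shift p sum_negf del: power_Suc sum.atMost_Suc)
      (simp add: bar_face_def single_uminus word_Cons)
qed

text \<open>
  From the third on, the faces are faces of the shorter cell behind \<open>a\<close>, with the opposite sign.
  The term \<open>prepend a c\<close> corrects for the outer face of that shorter cell, which is not a face of
  the longer one.
\<close>
lemma bar_boundary_prepend_prepend:
  "bar_boundary G (prepend a (prepend b c)) =
     prepend b c - prepend (a \<otimes>\<^bsub>G\<^esub> b) c + prepend a c - prepend a (bar_boundary G (prepend b c))"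
  using subset_UNIV [of "Poly_Mapping.keys c"]
proof (induction c rule: chain_induct)
  case (word \<sigma>)
  then show ?case
    using bar_boundary_Cons_Cons [of G a b \<sigma>] by (simp add: word_Cons)
qed simp_all

section \<open>Inserting a commuting element\<close>

text \<open>
  The signed sum of all ways to insert \<open>g\<close> into a word: the shuffle product
  of the cell \<open>[g]\<close> with the given one.  Iterating it on commuting elements gives fundamental cycles
  of tori.
\<close>
fun shuffle_word :: "'a \<Rightarrow> 'a list \<Rightarrow> ('a list \<Rightarrow>\<^sub>0 rat)" where
  "shuffle_word g [] = prepend g (word [])"
| "shuffle_word g (a # \<sigma>) = prepend g (prepend a (word \<sigma>)) - prepend a (shuffle_word g \<sigma>)"

definition shuffle :: "'a \<Rightarrow> ('a list \<Rightarrow>\<^sub>0 rat) \<Rightarrow> ('a list \<Rightarrow>\<^sub>0 rat)" where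
  "shuffle g = lin_extend (shuffle_word g)"

lemma shuffle_simps [simp]:
  "shuffle g 0 = 0" "shuffle g (c + d) = shuffle g c + shuffle g d"
  "shuffle g (c - d) = shuffle g c - shuffle g d" "shuffle g (- c) = - shuffle g c"
  "shuffle g (scale r c) = scale r (shuffle g c)"
  by (simp_all add: shuffle_def)

lemma shuffle_word_Nil [simp]: "shuffle g (word []) = prepend g (word [])"
  by (simp add: shuffle_def)

lemma shuffle_prepend [simp]:
  "shuffle g (prepend a c) = prepend g (prepend a c) - prepend a (shuffle g c)"
  using subset_UNIV [of "Poly_Mapping.keys c"]
  by (induction c rule: chain_induct) (simp_all add: shuffle_def word_Cons [symmetric])

text \<open>
  Of the faces that multiply \<open>g\<close> with a neighbour, the one with \<open>g\<close> left of an entry cancels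
  against the one with \<open>g\<close> right of it, since the two commute and the insertions carry opposite
  signs.  What remains are insertions into faces.
\<close>
lemma bar_boundary_shuffle:
  assumes c: "Poly_Mapping.keys c \<subseteq> lists A" and comm: "\<forall>h\<in>A. g \<otimes>\<^bsub>G\<^esub> h = h \<otimes>\<^bsub>G\<^esub> g"
  shows "bar_boundary G (shuffle g c) = - shuffle g (bar_boundary G c)"
  using c
proof (induction c rule: chain_induct)
  case (word \<sigma>)
  then show ?case
  proof (induction \<sigma> rule: list.induct)
    case (Cons a \<sigma>)
    have ga: "g \<otimes>\<^bsub>G\<^esub> a = a \<otimes>\<^bsub>G\<^esub> g"
      using Cons.prems comm by auto
    show ?case
    proof (cases \<sigma>)
      case Nil
      then show ?thesis
        using ga by (simp add: word_Cons bar_boundary_prepend_prepend)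
    next
      case (Cons b \<tau>)
      let ?w = "word \<tau>"
      have IH:
        "bar_boundary G (shuffle g (prepend b ?w)) = - shuffle g (bar_boundary G (prepend b ?w))"
        using Cons.IH Cons.prems Cons by (simp add: word_Cons)
      have "bar_boundary G (shuffle g (prepend a (prepend b ?w)))
          = - shuffle g (bar_boundary G (prepend a (prepend b ?w)))"
        using arg_cong [OF IH, of "prepend a"] ga
        by (simp add: bar_boundary_prepend_prepend algebra_simps)
      then show ?thesis
        by (simp add: Cons word_Cons)
    qed
  qed simp
qed simp_all

text \<open>
  On fundamental cycles of tori this is the interior product with \<open>\<omega>(g, _)\<close>, where \<open>\<omega>\<close> is the
  antisymmetrization of \<open>f\<close>.
\<close>
definition contract :: "('a \<Rightarrow> 'a \<Rightarrow> rat) \<Rightarrow> 'a \<Rightarrow> ('a list \<Rightarrow>\<^sub>0 rat) \<Rightarrow> ('a list \<Rightarrow>\<^sub>0 rat)" where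
  "contract f g =
     lin_extend (\<lambda>\<sigma>. case \<sigma> of [] \<Rightarrow> 0 | a # \<tau> \<Rightarrow> scale (f g a - f a g) (word \<tau>))"

lemma contract_simps [simp]:
  "contract f g 0 = 0" "contract f g (c + d) = contract f g c + contract f g d"
  "contract f g (c - d) = contract f g c - contract f g d" "contract f g (- c) = - contract f g c"
  "contract f g (scale r c) = scale r (contract f g c)" "contract f g (word []) = 0"
  by (simp_all add: contract_def)

lemma contract_prepend [simp]: "contract f g (prepend a c) = scale (f g a - f a g) c"
  using subset_UNIV [of "Poly_Mapping.keys c"]
  by (induction c rule: chain_induct) (simp_all add: contract_def word_Cons [symmetric] mult.commute)

text \<open>
  The cap product sees \<open>g\<close> only in the first two places, where the signs of the two insertions
  antisymmetrize \<open>f\<close>.  If \<open>g\<close> sits further back, it does not interfere with the first two entries.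
\<close>
lemma cap2_shuffle: "cap2 f (shuffle g c) = contract f g c + shuffle g (cap2 f c)"
  using subset_UNIV [of "Poly_Mapping.keys c"]
proof (induction c rule: chain_induct)
  case (word \<sigma>)
  consider "\<sigma> = []" | a where "\<sigma> = [a]" | a b \<tau> where "\<sigma> = a # b # \<tau>"
    by (metis neq_Nil_conv)
  then show ?case
    by cases (simp_all add: word_Cons scale_left_diff_distrib)
qed simp_all

lemma contract_shuffle:
  "contract f a (shuffle b c) = scale (f a b - f b a) c - shuffle b (contract f a c)"
  using subset_UNIV [of "Poly_Mapping.keys c"]
proof (induction c rule: chain_induct)
  case (word \<sigma>)
  show ?case
    by (cases \<sigma>) (simp_all add: word_Cons)
next
  case (add c d)
  then show ?case
    by (simp add: algebra_simps)
qed (simp_all add: mult.commute)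

lemma contract_eq_0:
  assumes "Poly_Mapping.keys c \<subseteq> lists A" "\<forall>h\<in>A. f g h = f h g"
  shows "contract f g c = 0"
  using assms(1)
proof (induction c rule: chain_induct)
  case (word \<sigma>)
  then show ?case
    using assms(2) by (cases \<sigma>) (simp_all add: word_Cons)
qed simp_all

text \<open>
  By the cocycle identity the first three faces together contribute the outer face of the part of
  the cell that the cap product leaves over; the remaining faces contribute its other faces.
\<close>
lemma cap2_bar_boundary:
  assumes c: "Poly_Mapping.keys c \<subseteq> lists A"
    and cocycle: "\<And>g h k. \<lbrakk>g \<in> A; h \<in> A; k \<in> A\<rbrakk> \<Longrightarrow>
      f g h + f (g \<otimes>\<^bsub>G\<^esub> h) k = f h k + f g (h \<otimes>\<^bsub>G\<^esub> k)"
  shows "cap2 f (bar_boundary G c) = bar_boundary G (cap2 f c)"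
  using c
proof (induction c rule: chain_induct)
  case (word \<sigma>)
  consider "\<sigma> = []" | a where "\<sigma> = [a]" | a b where "\<sigma> = [a, b]"
    | a b h \<tau> where "\<sigma> = a # b # h # \<tau>"
    by (cases \<sigma>; cases "tl \<sigma>"; cases "tl (tl \<sigma>)") auto
  then show ?case
  proof cases
    case 4
    let ?w = "word \<tau>"
    have "f a b + f (a \<otimes>\<^bsub>G\<^esub> b) h = f b h + f a (b \<otimes>\<^bsub>G\<^esub> h)"
      using word 4 by (intro cocycle) auto
    then have "f (a \<otimes>\<^bsub>G\<^esub> b) h = f b h + f a (b \<otimes>\<^bsub>G\<^esub> h) - f a b"
      by simp
    then have ab_h: "scale (f (a \<otimes>\<^bsub>G\<^esub> b) h) ?w
        = scale (f b h) ?w + scale (f a (b \<otimes>\<^bsub>G\<^esub> h)) ?w - scale (f a b) ?w"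
      by (simp add: scale_left_distrib scale_left_diff_distrib)
    show ?thesis
      by (simp add: 4 word_Cons bar_boundary_prepend_prepend ab_h)
  qed (simp_all add: word_Cons bar_boundary_prepend_prepend)
qed simp_all

lemma keys_scale: "Poly_Mapping.keys (scale r c) \<subseteq> Poly_Mapping.keys c"
  by (auto simp: in_keys_iff)

lemma cells_subset_lists: "cells A n \<subseteq> lists A"
  by (auto simp: cells_def)

lemma keys_prepend:
  assumes "Poly_Mapping.keys c \<subseteq> cells A n" "a \<in> A"
  shows "Poly_Mapping.keys (prepend a c) \<subseteq> cells A (Suc n)"
proof
  fix \<tau> assume "\<tau> \<in> Poly_Mapping.keys (prepend a c)"
  then obtain \<sigma> where "\<sigma> \<in> Poly_Mapping.keys c" "\<tau> = a # \<sigma>"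
    using keys_lin_extend [of "\<lambda>\<sigma>. word (a # \<sigma>)" c] by (auto simp: prepend_def)
  then show "\<tau> \<in> cells A (Suc n)"
    using assms by (auto simp: cells_def)
qed

lemma keys_shuffle:
  assumes "Poly_Mapping.keys c \<subseteq> cells A n"
  shows "Poly_Mapping.keys (shuffle g c) \<subseteq> cells (insert g A) (Suc n)"
proof -
  have "Poly_Mapping.keys (shuffle_word g \<sigma>) \<subseteq> cells (insert g A) (Suc (length \<sigma>))"
    if "set \<sigma> \<subseteq> A" for \<sigma>
    using that
  proof (induction \<sigma>)
    case (Cons a \<sigma>)
    then have "Poly_Mapping.keys (prepend a (shuffle_word g \<sigma>))
        \<subseteq> cells (insert g A) (Suc (length (a # \<sigma>)))"
      using keys_prepend [of "shuffle_word g \<sigma>" "insert g A" "Suc (length \<sigma>)" a] by simp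
    moreover have "g # a # \<sigma> \<in> cells (insert g A) (Suc (length (a # \<sigma>)))"
      using Cons.prems by (auto simp: cells_def)
    moreover have "Poly_Mapping.keys (prepend g (prepend a (word \<sigma>))) = {g # a # \<sigma>}"
      by (simp flip: word_Cons)
    ultimately show ?case
      using keys_diff [of "prepend g (prepend a (word \<sigma>))" "prepend a (shuffle_word g \<sigma>)"]
      by auto
  qed (simp add: cells_def flip: word_Cons)
  then have "Poly_Mapping.keys (shuffle_word g \<sigma>) \<subseteq> cells (insert g A) (Suc n)"
    if "\<sigma> \<in> Poly_Mapping.keys c" for \<sigma>
    using assms that unfolding cells_def by blast
  then show ?thesis
    using keys_lin_extend [of "shuffle_word g" c] unfolding shuffle_def by blast
qed

lemma keys_cap2:
  assumes "Poly_Mapping.keys c \<subseteq> cells A (Suc (Suc n))"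
  shows "Poly_Mapping.keys (cap2 f c) \<subseteq> cells A n"
proof
  fix \<tau> assume "\<tau> \<in> Poly_Mapping.keys (cap2 f c)"
  then obtain \<sigma> where "\<sigma> \<in> Poly_Mapping.keys c"
      "\<tau> \<in> Poly_Mapping.keys (case \<sigma> of a # b # \<tau> \<Rightarrow> Poly_Mapping.single \<tau> (f a b) | _ \<Rightarrow> 0)"
    using keys_lin_extend unfolding cap2_def by fast
  moreover from this have "\<sigma> \<in> cells A (Suc (Suc n))"
    using assms by blast
  ultimately show "\<tau> \<in> cells A n"
    by (auto simp: cells_def split: list.splits if_splits)
qed

text \<open>
  Each cap product lowers the degree by two and vanishes in degrees \<open>0\<close> and \<open>1\<close>.
\<close>
lemma cap2_nilpotent:
  assumes "Poly_Mapping.keys c \<subseteq> cells A n"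
  shows "\<exists>k. (cap2 f ^^ k) c = 0"
  using assms
proof (induction n arbitrary: c rule: induct_nat_012)
  case (ge2 n)
  then obtain k where "(cap2 f ^^ k) (cap2 f c) = 0"
    using keys_cap2 by blast
  then show ?case
    by (metis funpow_Suc_right o_apply)
next
  case 0
  then have "cap2 f c = 0"
    by (induction c rule: chain_induct) (simp_all add: cells_def)
  then show ?case
    by (intro exI [of _ 1]) simp
next
  case 1
  then have "cap2 f c = 0"
    by (induction c rule: chain_induct) (auto simp: cells_def length_Suc_conv word_Cons)
  then show ?case
    by (intro exI [of _ 1]) simp
qed

section \<open>Lifting cycles through the cap product\<close>

text \<open>
  A symplectic basis of infinite rank, made of commuting elements: the pairing is the
  antisymmetrization of a 2-cocycle \<open>f\<close>, and infinitely many hyperbolic pairs are available.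
\<close>
locale commuting_symplectic_sequences =
  fixes G :: "('a, 'b) monoid_scheme" and f :: "'a \<Rightarrow> 'a \<Rightarrow> rat" and \<alpha> \<beta> :: "nat \<Rightarrow> 'a"
  assumes closed: "\<alpha> i \<in> carrier G" "\<beta> i \<in> carrier G"
    and cocycle: "\<lbrakk>g \<in> carrier G; h \<in> carrier G; k \<in> carrier G\<rbrakk> \<Longrightarrow>
      f g h + f (g \<otimes>\<^bsub>G\<^esub> h) k = f h k + f g (h \<otimes>\<^bsub>G\<^esub> k)"
    and commute: "\<alpha> i \<otimes>\<^bsub>G\<^esub> \<alpha> j = \<alpha> j \<otimes>\<^bsub>G\<^esub> \<alpha> i" "\<beta> i \<otimes>\<^bsub>G\<^esub> \<beta> j = \<beta> j \<otimes>\<^bsub>G\<^esub> \<beta> i"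
      "\<alpha> i \<otimes>\<^bsub>G\<^esub> \<beta> j = \<beta> j \<otimes>\<^bsub>G\<^esub> \<alpha> i"
    and isotropic: "f (\<alpha> i) (\<alpha> j) = f (\<alpha> j) (\<alpha> i)" "f (\<beta> i) (\<beta> j) = f (\<beta> j) (\<beta> i)"
    and pairing: "f (\<alpha> i) (\<beta> j) - f (\<beta> j) (\<alpha> i) = (if i = j then 1 else 0)"
begin

definition first_pairs :: "nat \<Rightarrow> 'a set" where
  "first_pairs m = \<alpha> ` {..<m} \<union> \<beta> ` {..<m}"

text \<open>
  Cycles that use finitely many pairs only, so that the next pair is orthogonal to all their entries.
\<close>
definition cycles_on :: "nat \<Rightarrow> nat \<Rightarrow> ('a list \<Rightarrow>\<^sub>0 rat) set" where
  "cycles_on m n = {c. Poly_Mapping.keys c \<subseteq> cells (first_pairs m) n \<and> bar_boundary G c = 0}"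

text \<open>
  The product with the 2-torus that the \<open>m\<close>-th pair spans.
\<close>
definition torus_product :: "nat \<Rightarrow> ('a list \<Rightarrow>\<^sub>0 rat) \<Rightarrow> ('a list \<Rightarrow>\<^sub>0 rat)" where
  "torus_product m c = shuffle (\<alpha> m) (shuffle (\<beta> m) c)"

lemma torus_product_simps [simp]:
  "torus_product m 0 = 0" "torus_product m (c + d) = torus_product m c + torus_product m d"
  "torus_product m (scale r c) = scale r (torus_product m c)"
  by (simp_all add: torus_product_def)

lemma first_pairs_subset: "first_pairs m \<subseteq> carrier G"
  using closed by (auto simp: first_pairs_def)

lemma cycles_on_mono: "m \<le> m' \<Longrightarrow> cycles_on m n \<subseteq> cycles_on m' n"
  by (fastforce simp: cycles_on_def cells_def first_pairs_def)

lemma cycles_on_add: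
  assumes "c \<in> cycles_on m n" "d \<in> cycles_on m n" shows "c + d \<in> cycles_on m n"
  using assms keys_add [of c d] by (auto simp: cycles_on_def)

lemma cycles_on_scale: "c \<in> cycles_on m n \<Longrightarrow> scale r c \<in> cycles_on m n"
  using keys_scale [of r c] by (auto simp: cycles_on_def)

lemma cycles_on_diff:
  assumes "c \<in> cycles_on m n" "d \<in> cycles_on m n" shows "c - d \<in> cycles_on m n"
  using assms keys_diff [of c d] by (auto simp: cycles_on_def)

lemma cap2_boundary:
  assumes "Poly_Mapping.keys c \<subseteq> cells (carrier G) n"
  shows "cap2 f (bar_boundary G c) = bar_boundary G (cap2 f c)"
  using assms cells_subset_lists by (intro cap2_bar_boundary [where A = "carrier G"] cocycle) blast+

lemma cap2_cycles_on:
  assumes "c \<in> cycles_on m (Suc (Suc n))" shows "cap2 f c \<in> cycles_on m n"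
proof -
  have "Poly_Mapping.keys c \<subseteq> cells (carrier G) (Suc (Suc n))"
    using assms first_pairs_subset [of m] by (auto simp: cycles_on_def cells_def)
  then show ?thesis
    using assms cap2_boundary [of c "Suc (Suc n)"] keys_cap2 [of c "first_pairs m" n f]
    by (simp add: cycles_on_def)
qed

lemma torus_product_cycles_on:
  assumes "c \<in> cycles_on m n" shows "torus_product m c \<in> cycles_on (Suc m) (Suc (Suc n))"
proof -
  let ?A = "first_pairs m"
  have c: "Poly_Mapping.keys c \<subseteq> cells ?A n" "bar_boundary G c = 0"
    using assms by (auto simp: cycles_on_def)
  have 1: "Poly_Mapping.keys (shuffle (\<beta> m) c) \<subseteq> cells (insert (\<beta> m) ?A) (Suc n)"
    using c(1) by (rule keys_shuffle)
  then have "Poly_Mapping.keys (torus_product m c) \<subseteq> cells (insert (\<alpha> m) (insert (\<beta> m) ?A)) (Suc (Suc n))"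
    unfolding torus_product_def by (rule keys_shuffle)
  also have "insert (\<alpha> m) (insert (\<beta> m) ?A) = first_pairs (Suc m)"
    by (auto simp: first_pairs_def lessThan_Suc)
  finally have "Poly_Mapping.keys (torus_product m c) \<subseteq> cells (first_pairs (Suc m)) (Suc (Suc n))" .
  moreover have "bar_boundary G (shuffle (\<beta> m) c) = 0"
    using subset_trans [OF c(1) cells_subset_lists] c(2) commute
    by (subst bar_boundary_shuffle [where A = ?A]) (auto simp add: first_pairs_def)
  then have "bar_boundary G (torus_product m c) = 0"
    unfolding torus_product_def using subset_trans [OF 1 cells_subset_lists] commute
    by (subst bar_boundary_shuffle [where A = "insert (\<beta> m) ?A"]) (auto simp: first_pairs_def)
  ultimately show ?thesis
    by (simp add: cycles_on_def)
qed

text \<open>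
  The new pair contributes its pairing \<open>1\<close>; every mixed term contracts an element of the new pair
  with an entry of \<open>c\<close>, to which it is orthogonal.
\<close>
lemma cap2_torus_product:
  assumes "Poly_Mapping.keys c \<subseteq> lists (first_pairs m)"
  shows "cap2 f (torus_product m c) = c + torus_product m (cap2 f c)"
proof -
  have ab: "f (\<alpha> m) (\<beta> i) = f (\<beta> i) (\<alpha> m)" "f (\<beta> m) (\<alpha> i) = f (\<alpha> i) (\<beta> m)" if "i < m" for i
    using that pairing [of m i] pairing [of i m] by auto
  have "contract f (\<alpha> m) c = 0" "contract f (\<beta> m) c = 0"
    by (rule contract_eq_0 [OF assms]; use ab isotropic in \<open>auto simp: first_pairs_def\<close>)+
  then show ?thesis
    by (simp add: torus_product_def cap2_shuffle contract_shuffle pairing)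
qed

lemma cap2_funpow_keys:
  assumes "Poly_Mapping.keys c \<subseteq> lists A"
  shows "Poly_Mapping.keys ((cap2 f ^^ k) c) \<subseteq> lists A"
proof (induction k)
  case (Suc k)
  show ?case
  proof
    fix \<tau> assume "\<tau> \<in> Poly_Mapping.keys ((cap2 f ^^ Suc k) c)"
    then obtain \<sigma> where "\<sigma> \<in> Poly_Mapping.keys ((cap2 f ^^ k) c)"
        "\<tau> \<in> Poly_Mapping.keys (case \<sigma> of a # b # \<tau> \<Rightarrow> Poly_Mapping.single \<tau> (f a b) | _ \<Rightarrow> 0)"
      using keys_lin_extend unfolding cap2_def funpow.simps o_apply by fast
    then show "\<tau> \<in> lists A"
      using Suc.IH by (auto split: list.splits if_splits)
  qed
qed (use assms in simp)

text \<open>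
  With \<open>D\<close> the cap product and \<open>V\<close> the torus product, \<open>DV = 1 + VD\<close> is the
  canonical commutation relation, whence \<open>D\<^bsup>k+1\<^esup>V = (k+1) D\<^bsup>k\<^esup> + VD\<^bsup>k+1\<^esup>\<close>.
\<close>
lemma cap2_funpow_torus_product:
  assumes c: "Poly_Mapping.keys c \<subseteq> lists (first_pairs m)"
  shows "(cap2 f ^^ Suc k) (torus_product m c)
    = scale (of_nat (Suc k)) ((cap2 f ^^ k) c) + torus_product m ((cap2 f ^^ Suc k) c)"
proof (induction k)
  case 0
  show ?case
    using cap2_torus_product [OF c] by simp
next
  case (Suc k)
  have "scale (of_nat (Suc (Suc k))) e = e + scale (of_nat (Suc k)) e" for e :: "'a list \<Rightarrow>\<^sub>0 rat"
    by (subst of_nat_Suc) (simp only: scale_left_distrib scale_simps)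
  then show ?case
    using cap2_torus_product [OF cap2_funpow_keys [OF c, of "Suc k"]] Suc.IH
    by (simp del: of_nat_Suc add: algebra_simps)
qed

text \<open>
  Induction on the order \<open>k\<close> of nilpotency of the cap product \<open>D\<close> at \<open>c\<close>.  If \<open>D\<^bsup>k+1\<^esup> c = 0\<close>,
  then \<open>d = (k+1) c - DVc\<close>, with \<open>V\<close> the product with a fresh torus, satisfies \<open>D\<^bsup>k\<^esup> d = 0\<close> by the
  commutation relation.  So \<open>d = De\<close> for some \<open>e\<close>, and \<open>(k+1) c = D(e + Vc)\<close>.  The
  torus has to be fresh at each stage, because \<open>d\<close> involves one pair more than \<open>c\<close>.
\<close>
lemma cap2_surj_on_cycles:
  assumes "c \<in> cycles_on m n" "(cap2 f ^^ k) c = 0"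
  shows "\<exists>m' c'. c' \<in> cycles_on m' (Suc (Suc n)) \<and> cap2 f c' = c"
  using assms
proof (induction k arbitrary: m c)
  case 0
  then show ?case
    by (intro exI [of _ m] exI [of _ 0]) (simp add: cycles_on_def)
next
  case (Suc k)
  let ?r = "of_nat (Suc k) :: rat"
  define d where "d = scale ?r c - cap2 f (torus_product m c)"
  have keys: "Poly_Mapping.keys c \<subseteq> lists (first_pairs m)"
    using Suc.prems(1) subset_trans [OF _ cells_subset_lists]
    unfolding cycles_on_def by blast
  have t: "torus_product m c \<in> cycles_on (Suc m) (Suc (Suc n))"
    by (rule torus_product_cycles_on [OF Suc.prems(1)])
  have d: "d \<in> cycles_on (Suc m) n"
    unfolding d_def using Suc.prems(1) cycles_on_mono [of m "Suc m" n]
    by (auto intro!: cycles_on_diff cycles_on_scale cap2_cycles_on t)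
  have lin: "(cap2 f ^^ k) (scale r e - e') = scale r ((cap2 f ^^ k) e) - (cap2 f ^^ k) e'" for r e e'
    by (induction k) simp_all
  have "(cap2 f ^^ k) d = scale ?r ((cap2 f ^^ k) c) - (cap2 f ^^ Suc k) (torus_product m c)"
    unfolding d_def lin by (simp only: funpow_Suc_right o_apply)
  also have "\<dots> = 0"
    unfolding cap2_funpow_torus_product [OF keys] Suc.prems(2) by simp
  finally obtain m' e where e: "e \<in> cycles_on m' (Suc (Suc n))" "cap2 f e = d"
    using Suc.IH [OF d] by blast
  define c' where "c' = scale (inverse ?r) (e + torus_product m c)"
  have "cap2 f c' = c"
    unfolding c'_def by (simp add: e(2) d_def del: of_nat_Suc)
  moreover have "c' \<in> cycles_on (max m' (Suc m)) (Suc (Suc n))"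
    unfolding c'_def
    using e(1) t cycles_on_mono [of m' "max m' (Suc m)"] cycles_on_mono [of "Suc m" "max m' (Suc m)"]
    by (intro cycles_on_scale cycles_on_add) auto
  ultimately show ?case
    by blast
qed

text \<open>
  The cap product lifts each cycle to one of degree two more, so dependent choice gives a
  compatible system above the empty cell.
\<close>
lemma coherent_cycles:
  "\<exists>c. c 0 = word [] \<and> (\<forall>n. Poly_Mapping.keys (c n) \<subseteq> cells (carrier G) (2 * n)
      \<and> bar_boundary G (c n) = 0 \<and> cap2 f (c (Suc n)) = c n)"
proof -
  define Z where "Z n = (\<Union>m. cycles_on m (2 * n))" for n
  have Z0: "word [] \<in> Z 0"
    by (simp add: Z_def cycles_on_def cells_def)
  have step: "\<exists>c'. c' \<in> Z (Suc n) \<and> cap2 f c' = c" if c: "c \<in> Z n" for n c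
  proof -
    obtain m where m: "c \<in> cycles_on m (2 * n)"
      using c unfolding Z_def by blast
    then obtain k where "(cap2 f ^^ k) c = 0"
      using cap2_nilpotent by (fastforce simp: cycles_on_def)
    then obtain m' c' where "c' \<in> cycles_on m' (Suc (Suc (2 * n)))" "cap2 f c' = c"
      using cap2_surj_on_cycles [OF m] by blast
    then show ?thesis
      unfolding Z_def by (auto intro!: exI [of _ c'])
  qed
  obtain z where z: "z 0 = word []" "\<forall>n. z n \<in> Z n" "\<forall>n. cap2 f (z (Suc n)) = z n"
  proof -
    define z where "z = rec_nat (word []) (\<lambda>n c. SOME c'. c' \<in> Z (Suc n) \<and> cap2 f c' = c)"
    have s: "z (Suc n) \<in> Z (Suc n) \<and> cap2 f (z (Suc n)) = z n" if "z n \<in> Z n" for n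
      using someI_ex [OF step [OF that]] by (simp add: z_def)
    have "z n \<in> Z n" for n
      by (induction n) (use Z0 s in \<open>auto simp: z_def\<close>)
    then show ?thesis
      using s that [of z] by (simp add: z_def)
  qed
  have "Z n \<subseteq> {c. Poly_Mapping.keys c \<subseteq> cells (carrier G) (2 * n) \<and> bar_boundary G c = 0}" for n
    using first_pairs_subset by (fastforce simp: Z_def cycles_on_def cells_def)
  then show ?thesis
    using z by blast
qed

end

section \<open>From coherent cycles to the inverse limit\<close>
lemma bar_chains_eq: "bar_chains G n = {c. Poly_Mapping.keys c \<subseteq> cells (carrier G) n}"
  by (simp add: bar_chains_def bar_cells_def cells_def)

lemma bar_boundaries_zero: "0 \<in> bar_boundaries G n"
  unfolding bar_boundaries_def bar_chains_eq by (rule image_eqI [of _ _ 0]) simp_all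

lemma bar_boundaries_add:
  assumes "b \<in> bar_boundaries G n" "b' \<in> bar_boundaries G n" shows "b + b' \<in> bar_boundaries G n"
proof -
  obtain d d' where "b = bar_boundary G d" "b' = bar_boundary G d'"
      "d \<in> bar_chains G (Suc n)" "d' \<in> bar_chains G (Suc n)"
    using assms by (auto simp: bar_boundaries_def)
  moreover from this have "d + d' \<in> bar_chains G (Suc n)"
    using keys_add [of d d'] by (auto simp: bar_chains_eq)
  ultimately show ?thesis
    unfolding bar_boundaries_def by (auto intro!: image_eqI [of _ _ "d + d'"])
qed

lemma bar_boundaries_minus: "b \<in> bar_boundaries G n \<Longrightarrow> - b \<in> bar_boundaries G n"
  unfolding bar_boundaries_def bar_chains_eq
  by (auto intro!: image_eqI [of _ _ "- d" for d])

lemma homology_class_eq: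
  "bar_boundaries G n #>\<^bsub>bar_cycle_group G n\<^esub> c = {b + c |b. b \<in> bar_boundaries G n}"
  by (auto simp: r_coset_def bar_cycle_group_def)

lemma homology_class_add_boundary:
  assumes "b \<in> bar_boundaries G n"
  shows "bar_boundaries G n #>\<^bsub>bar_cycle_group G n\<^esub> (b + c)
    = bar_boundaries G n #>\<^bsub>bar_cycle_group G n\<^esub> c"
proof -
  have "\<exists>b'. b'' + (b + c) = b' + c \<and> b' \<in> bar_boundaries G n"
    and "\<exists>b'. b'' + c = b' + (b + c) \<and> b' \<in> bar_boundaries G n"
    if "b'' \<in> bar_boundaries G n" for b''
    using bar_boundaries_add [OF that assms]
      bar_boundaries_add [OF that bar_boundaries_minus [OF assms]]
    by (auto simp: add.assoc intro: exI [of _ "b'' + b"] exI [of _ "b'' + - b"])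
  then show ?thesis
    unfolding homology_class_eq by blast
qed

text \<open>
  The two faces of a 1-cell are both the empty cell, with opposite signs.
\<close>
lemma bar_boundaries_degree_0: "bar_boundaries G 0 = {0}"
proof -
  have "bar_boundary G d = 0" if "Poly_Mapping.keys d \<subseteq> cells (carrier G) 1" for d
    using that
  proof (induction d rule: chain_induct)
    case (word \<sigma>)
    then obtain a where "\<sigma> = [a]"
      by (auto simp: cells_def length_Suc_conv)
    then show ?case
      by (simp add: word_Cons)
  qed simp_all
  then show ?thesis
    using bar_boundaries_zero [of G 0] by (auto simp: bar_boundaries_def bar_chains_eq)
qed

text \<open>
  The Gysin homomorphism sends the class of \<open>c\<^bsub>n+1\<^esub>\<close> to the class of \<open>c\<^sub>n\<close>: on representatives the
  cap product does so exactly, and it maps boundaries to boundaries.  The resulting thread is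
  nontrivial already at its bottom.
\<close>
lemma burghelea_T_nontrivial:
  assumes "commuting_symplectic_sequences (reduced_centralizer G x)
      (\<lambda>A B. of_int (extension_cocycle G x A B)) \<alpha> \<beta>"
  shows "carrier (burghelea_T G x 0) \<noteq> {\<one>\<^bsub>burghelea_T G x 0\<^esub>}"
proof -
  define N where "N = reduced_centralizer G x"
  define f where "f A B = rat_of_int (extension_cocycle G x A B)" for A B
  interpret commuting_symplectic_sequences N f \<alpha> \<beta>
    using assms unfolding N_def f_def .
  obtain c where c: "c 0 = word []" "\<And>n. Poly_Mapping.keys (c n) \<subseteq> cells (carrier N) (2 * n)"
      "\<And>n. bar_boundary N (c n) = 0" "\<And>n. cap2 f (c (Suc n)) = c n"
    using coherent_cycles by blast
  define h where "h n = bar_boundaries N (2 * n) #>\<^bsub>bar_cycle_group N (2 * n)\<^esub> c n" for n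
  have "h n \<in> carrier (rat_homology N (2 * n))" for n
    unfolding h_def rat_homology_def carrier_FactGroup
    using c by (auto simp: bar_cycle_group_def bar_chains_eq)
  \<comment> \<open>All members of the class give the same coset, so the union that defines the map is that coset.\<close>
  moreover have "gysin G x (2 * n) (h (Suc n)) = h n" for n
  proof -
    have b: "cap2 f b \<in> bar_boundaries N (2 * n)" if b: "b \<in> bar_boundaries N (2 * Suc n)" for b
    proof -
      obtain d where d: "b = bar_boundary N d"
          "Poly_Mapping.keys d \<subseteq> cells (carrier N) (Suc (Suc (Suc (2 * n))))"
        using b by (auto simp: bar_boundaries_def bar_chains_eq)
      then show ?thesis
        using keys_cap2 [OF d(2), of f] cap2_boundary [OF d(2)]
        by (auto simp: bar_boundaries_def bar_chains_eq)
    qed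
    have "bar_boundaries N (2 * n) #>\<^bsub>bar_cycle_group N (2 * n)\<^esub> cap2 f e = h n"
      if e: "e \<in> h (Suc n)" for e
    proof -
      obtain b where "b \<in> bar_boundaries N (2 * Suc n)" "e = b + c (Suc n)"
        using e unfolding h_def homology_class_eq by auto
      then show ?thesis
        by (simp add: c(4) homology_class_add_boundary [OF b] h_def del: mult_Suc_right)
    qed
    moreover have "h (Suc n) \<noteq> {}"
      using bar_boundaries_zero unfolding h_def homology_class_eq by auto
    ultimately show ?thesis
      unfolding gysin_def Let_def N_def [symmetric] f_def [symmetric] by simp
  qed
  ultimately have "h \<in> carrier (burghelea_T G x 0)"
    by (simp add: burghelea_T_def Let_def PiE_def N_def)
  moreover have "h \<noteq> \<one>\<^bsub>burghelea_T G x 0\<^esub>"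
  proof
    assume "h = \<one>\<^bsub>burghelea_T G x 0\<^esub>"
    then have "h 0 = bar_boundaries N 0"
      by (simp add: burghelea_T_def Let_def rat_homology_def FactGroup_def N_def)
    moreover have "h 0 = {word []}"
      unfolding h_def homology_class_eq by (simp add: c(1) bar_boundaries_degree_0)
    ultimately have "word [] = (0 :: 'a set list \<Rightarrow>\<^sub>0 rat)"
      by (simp add: bar_boundaries_degree_0)
    then show False
      by (metis lookup_single_eq lookup_zero zero_neq_one)
  qed
  ultimately show ?thesis
    by blast
qed

section \<open>The cocycle of the central extension\<close>
locale infinite_order_element = group G for G (structure) +
  fixes x
  assumes x_closed [simp]: "x \<in> carrier G" and infinite_order: "infinite_order G x"
begin

abbreviation C where "C \<equiv> centralizer_group G x"
abbreviation Z where "Z \<equiv> generate C {x}"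
abbreviation N where "N \<equiv> reduced_centralizer G x"

lemma carrier_C: "carrier C = {g \<in> carrier G. g \<otimes> x = x \<otimes> g}"
  and mult_C [simp]: "monoid.mult C = monoid.mult G"
  by (simp_all add: centralizer_group_def)

lemma int_pow_inject: "x [^] (k :: int) = x [^] (l :: int) \<longleftrightarrow> k = l"
proof -
  have "ord x = 0"
    using infinite_order by (auto simp: ord_eq_0 infinite_order_def)
  then show ?thesis
    by (auto simp: int_pow_eq)
qed

lemma subgroup_centralizer:
  assumes y: "y \<in> carrier G" shows "subgroup {g \<in> carrier G. g \<otimes> y = y \<otimes> g} G"
proof (rule subgroupI)
  fix g assume g: "g \<in> {g \<in> carrier G. g \<otimes> y = y \<otimes> g}"
  then have "g \<otimes> (y \<otimes> inv g) = y \<otimes> g \<otimes> inv g"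
    using y by (simp flip: m_assoc)
  then have "y = g \<otimes> (y \<otimes> inv g)"
    using g y by (simp add: m_assoc)
  then show "inv g \<in> {g \<in> carrier G. g \<otimes> y = y \<otimes> g}"
    using g y by (metis (mono_tags, lifting) inv_closed inv_solve_left m_closed mem_Collect_eq)
next
  fix g h assume "g \<in> {g \<in> carrier G. g \<otimes> y = y \<otimes> g}" "h \<in> {g \<in> carrier G. g \<otimes> y = y \<otimes> g}"
  then show "g \<otimes> h \<in> {g \<in> carrier G. g \<otimes> y = y \<otimes> g}"
    using y by (simp add: m_assoc) (simp flip: m_assoc)
qed (use y in auto)

lemma subgroup_C: "subgroup (carrier C) G"
  using subgroup_centralizer [OF x_closed] by (simp add: carrier_C)

lemma C_eq: "C = G\<lparr>carrier := carrier C\<rparr>"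
  by (simp add: centralizer_group_def)

lemma group_C: "group C"
  using subgroup.subgroup_is_group [OF subgroup_C group_axioms] C_eq by simp

lemma x_in_C: "x \<in> carrier C"
  by (simp add: carrier_C)

lemma Z_eq: "Z = range (\<lambda>k::int. x [^] k)"
proof -
  have "Z = generate G {x}"
    using generate_consistent [OF _ subgroup_C, of "{x}"] C_eq x_in_C by simp
  then show ?thesis
    by (auto simp: generate_pow)
qed

text \<open>
  Powers of \<open>x\<close> lie in the centralizer of \<open>g\<close>, a subgroup that contains \<open>x\<close>.
\<close>
lemma int_pow_central:
  assumes "g \<in> carrier C" shows "g \<otimes> x [^] (k :: int) = x [^] k \<otimes> g"
proof -
  have "x [^] k \<in> {y \<in> carrier G. y \<otimes> g = g \<otimes> y}"
    using assms by (intro subgroup_int_pow_closed subgroup_centralizer) (simp_all add: carrier_C)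
  then show ?thesis
    by simp
qed

lemma normal_Z: "Z \<lhd> C"
proof -
  interpret C: group C
    by (rule group_C)
  have "subgroup Z C"
    using x_in_C by (intro C.generate_is_subgroup) simp
  then show ?thesis
    by (rule C.normalI) (auto simp: r_coset_def l_coset_def Z_eq int_pow_central)
qed

lemma coset_eq: "Z #>\<^bsub>C\<^esub> g = {x [^] (k :: int) \<otimes> g |k. True}"
  by (auto simp: r_coset_def Z_eq)

lemma carrier_N: "carrier N = {Z #>\<^bsub>C\<^esub> g |g. g \<in> carrier C}"
  by (auto simp: reduced_centralizer_def carrier_FactGroup)

lemma group_N: "group N"
  unfolding reduced_centralizer_def by (rule normal.factorgroup_is_group [OF normal_Z])

lemma mult_N:
  assumes "g \<in> carrier C" "h \<in> carrier C"
  shows "(Z #>\<^bsub>C\<^esub> g) \<otimes>\<^bsub>N\<^esub> (Z #>\<^bsub>C\<^esub> h) = Z #>\<^bsub>C\<^esub> (g \<otimes> h)"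
  using normal.rcos_sum [OF normal_Z assms] by (simp add: reduced_centralizer_def FactGroup_def)

lemma coset_int_pow_mult:
  assumes "g \<in> carrier C" shows "Z #>\<^bsub>C\<^esub> (x [^] (k :: int) \<otimes> g) = Z #>\<^bsub>C\<^esub> g"
proof -
  have g: "g \<in> carrier G"
    using assms by (simp add: carrier_C)
  have "x [^] (i :: int) \<otimes> (x [^] k \<otimes> g) = x [^] (i + k) \<otimes> g" for i
    using g by (simp add: int_pow_mult m_assoc)
  then show ?thesis
    unfolding coset_eq by (auto, metis diff_add_cancel)
qed

lemma coset_section_coset:
  assumes "g \<in> carrier C"
  obtains k :: int where "coset_section (Z #>\<^bsub>C\<^esub> g) = x [^] k \<otimes> g"
proof -
  have "\<exists>a. a \<in> Z #>\<^bsub>C\<^esub> g"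
    unfolding coset_eq by blast
  then have "coset_section (Z #>\<^bsub>C\<^esub> g) \<in> Z #>\<^bsub>C\<^esub> g"
    unfolding coset_section_def by (rule someI_ex)
  then show thesis
    using that by (auto simp: coset_eq)
qed

lemma coset_section_N:
  assumes "A \<in> carrier N"
  shows "coset_section A \<in> carrier C" "Z #>\<^bsub>C\<^esub> coset_section A = A"
proof -
  obtain g where g: "g \<in> carrier C" "A = Z #>\<^bsub>C\<^esub> g"
    using assms by (auto simp: carrier_N)
  then obtain k :: int where k: "coset_section A = x [^] k \<otimes> g"
    using coset_section_coset by metis
  have "x [^] k \<in> carrier C"
    using subgroup_int_pow_closed [OF subgroup_C x_in_C] .
  then show "coset_section A \<in> carrier C"
    unfolding k using subgroup.m_closed [OF subgroup_C] g(1) by blast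
  show "Z #>\<^bsub>C\<^esub> coset_section A = A"
    unfolding k unfolding g(2) by (rule coset_int_pow_mult [OF g(1)])
qed

lemma int_pow_mult_inject:
  assumes "g \<in> carrier G" "x [^] (k :: int) \<otimes> g = x [^] (l :: int) \<otimes> g" shows "k = l"
  using assms by (simp add: int_pow_inject)

abbreviation f where "f \<equiv> extension_cocycle G x"
abbreviation s where "s \<equiv> coset_section"

lemma section_mult:
  assumes A: "A \<in> carrier N" and B: "B \<in> carrier N"
  shows "s A \<otimes> s B = x [^] f A B \<otimes> s (A \<otimes>\<^bsub>N\<^esub> B)"
proof -
  have sA: "s A \<in> carrier C" "s B \<in> carrier C"
    using A B coset_section_N by auto
  then have AB: "A \<otimes>\<^bsub>N\<^esub> B = Z #>\<^bsub>C\<^esub> (s A \<otimes> s B)"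
    using mult_N [OF sA] coset_section_N A B by simp
  have sAsB: "s A \<otimes> s B \<in> carrier C"
    using sA subgroup.m_closed [OF subgroup_C] by blast
  then obtain k :: int where k: "s (A \<otimes>\<^bsub>N\<^esub> B) = x [^] k \<otimes> (s A \<otimes> s B)"
    unfolding AB using coset_section_coset by blast
  have mem: "s A \<otimes> s B \<in> carrier G"
    using sAsB by (simp add: carrier_C)
  have ex: "s A \<otimes> s B = x [^] (- k) \<otimes> s (A \<otimes>\<^bsub>N\<^esub> B)"
    unfolding k using mem by (simp add: int_pow_neg flip: m_assoc)
  have "s (A \<otimes>\<^bsub>N\<^esub> B) \<in> carrier G"
    unfolding k using mem by simp
  then have "\<exists>!k :: int. s A \<otimes> s B = x [^] k \<otimes> s (A \<otimes>\<^bsub>N\<^esub> B)"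
    using ex int_pow_mult_inject by metis
  then show ?thesis
    unfolding extension_cocycle_def by (rule theI')
qed

text \<open>
  Associativity of \<open>s A \<otimes> s B \<otimes> s D\<close>, once both ways of bracketing are collected as a power of \<open>x\<close>
  times the chosen representative of the product.
\<close>
lemma extension_cocycle_cocycle:
  assumes "A \<in> carrier N" "B \<in> carrier N" "D \<in> carrier N"
  shows "f A B + f (A \<otimes>\<^bsub>N\<^esub> B) D = f B D + f A (B \<otimes>\<^bsub>N\<^esub> D)"
proof -
  interpret N: group N
    by (rule group_N)
  have s: "s E \<in> carrier G" if "E \<in> carrier N" for E
    using coset_section_N(1) [OF that] by (simp add: carrier_C)
  let ?t = "s (A \<otimes>\<^bsub>N\<^esub> B \<otimes>\<^bsub>N\<^esub> D)"
  have t: "?t \<in> carrier G"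
    using assms s by simp
  have "x [^] (f A B + f (A \<otimes>\<^bsub>N\<^esub> B) D) \<otimes> ?t = x [^] f A B \<otimes> (s (A \<otimes>\<^bsub>N\<^esub> B) \<otimes> s D)"
    using assms t by (simp add: section_mult int_pow_mult m_assoc)
  also have "\<dots> = s A \<otimes> s B \<otimes> s D"
    using assms s by (simp add: section_mult m_assoc)
  also have "\<dots> = s A \<otimes> (x [^] f B D \<otimes> s (B \<otimes>\<^bsub>N\<^esub> D))"
    using assms s by (simp add: m_assoc section_mult [of B D, symmetric])
  also have "\<dots> = x [^] f B D \<otimes> (s A \<otimes> s (B \<otimes>\<^bsub>N\<^esub> D))"
    using assms s int_pow_central [OF coset_section_N(1)] by (simp flip: m_assoc)
  also have "\<dots> = x [^] (f B D + f A (B \<otimes>\<^bsub>N\<^esub> D)) \<otimes> ?t"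
    using assms t by (simp add: section_mult int_pow_mult m_assoc N.m_assoc)
  finally show ?thesis
    using int_pow_mult_inject [OF t] by blast
qed

text \<open>
  Two representatives of a coset differ by a central power of \<open>x\<close>, which does not affect commutators.
  So the antisymmetrized cocycle reads off the commutator of arbitrary
  representatives, and the unspecified section drops out.
\<close>
lemma cosets_of_commutator:
  assumes g: "g \<in> carrier C" and h: "h \<in> carrier C" and comm: "g \<otimes> h = x [^] (k :: int) \<otimes> (h \<otimes> g)"
  defines "A \<equiv> Z #>\<^bsub>C\<^esub> g" and "B \<equiv> Z #>\<^bsub>C\<^esub> h"
  shows "A \<otimes>\<^bsub>N\<^esub> B = B \<otimes>\<^bsub>N\<^esub> A" "f A B - f B A = k"
proof -
  have gh: "h \<otimes> g \<in> carrier C" "g \<in> carrier G" "h \<in> carrier G"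
    using g h subgroup.m_closed [OF subgroup_C] by (auto simp: carrier_C)
  show AB: "A \<otimes>\<^bsub>N\<^esub> B = B \<otimes>\<^bsub>N\<^esub> A"
    by (simp add: A_def B_def mult_N g h comm coset_int_pow_mult gh(1))
  have N: "A \<in> carrier N" "B \<in> carrier N"
    using g h by (auto simp: A_def B_def carrier_N)
  obtain i j :: int where i: "s A = x [^] i \<otimes> g" and j: "s B = x [^] j \<otimes> h"
    using coset_section_coset g h unfolding A_def B_def by metis
  have "s A \<otimes> s B = x [^] i \<otimes> (g \<otimes> x [^] j) \<otimes> h"
    using gh by (simp add: i j m_assoc)
  also have "\<dots> = x [^] (i + j) \<otimes> (g \<otimes> h)"
    using gh g by (simp add: int_pow_central m_assoc int_pow_mult)
  also have "\<dots> = x [^] (i + j + k) \<otimes> (h \<otimes> g)"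
    using gh by (simp add: comm int_pow_mult m_assoc)
  also have "\<dots> = x [^] (k + (j + i)) \<otimes> (h \<otimes> g)"
    by (simp add: ac_simps)
  also have "\<dots> = x [^] k \<otimes> (x [^] j \<otimes> (h \<otimes> x [^] i) \<otimes> g)"
    using gh h by (simp add: int_pow_central m_assoc int_pow_mult)
  also have "\<dots> = x [^] k \<otimes> (s B \<otimes> s A)"
    using gh by (simp add: i j m_assoc)
  finally have "x [^] f A B \<otimes> s (A \<otimes>\<^bsub>N\<^esub> B) = x [^] (k + f B A) \<otimes> s (A \<otimes>\<^bsub>N\<^esub> B)"
    using N coset_section_N(1) [of "A \<otimes>\<^bsub>N\<^esub> B"] group.is_monoid [OF group_N]
    by (simp add: section_mult AB int_pow_mult m_assoc carrier_C monoid.m_closed)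
  then show "f A B - f B A = k"
    using int_pow_mult_inject coset_section_N(1) [of "A \<otimes>\<^bsub>N\<^esub> B"] N
      monoid.m_closed [OF group.is_monoid [OF group_N]] by (fastforce simp: carrier_C)
qed

lemma commuting_symplectic_sequences_in_N:
  fixes a b :: "nat \<Rightarrow> 'a"
  assumes "\<And>i. a i \<in> carrier G" "\<And>i. b i \<in> carrier G"
    and "\<And>i. a i \<otimes> x = x \<otimes> a i" "\<And>i. b i \<otimes> x = x \<otimes> b i"
    and aa: "\<And>i j. a i \<otimes> a j = a j \<otimes> a i" and bb: "\<And>i j. b i \<otimes> b j = b j \<otimes> b i"
    and ab: "\<And>i j. a i \<otimes> b j = (if i = j then x else \<one>) \<otimes> (b j \<otimes> a i)"
  shows "commuting_symplectic_sequences N (\<lambda>A B. of_int (f A B))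
    (\<lambda>i. Z #>\<^bsub>C\<^esub> a i) (\<lambda>i. Z #>\<^bsub>C\<^esub> b i)"
proof -
  have C: "a i \<in> carrier C" "b i \<in> carrier C" for i
    using assms by (auto simp: carrier_C)
  have "a i \<otimes> a j = x [^] (0::int) \<otimes> (a j \<otimes> a i)" "b i \<otimes> b j = x [^] (0::int) \<otimes> (b j \<otimes> b i)"
    "a i \<otimes> b j = x [^] (if i = j then 1 else 0 :: int) \<otimes> (b j \<otimes> a i)" for i j
    using assms by auto
  note comm = this [THEN cosets_of_commutator(1) [rotated 2]] this [THEN cosets_of_commutator(2) [rotated 2]]
  show ?thesis
  proof
    fix A B D assume "A \<in> carrier N" "B \<in> carrier N" "D \<in> carrier N"
    then show "rat_of_int (f A B) + of_int (f (A \<otimes>\<^bsub>N\<^esub> B) D)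
        = of_int (f B D) + of_int (f A (B \<otimes>\<^bsub>N\<^esub> D))"
      by (metis extension_cocycle_cocycle of_int_add)
  next
    fix i j
    show "rat_of_int (f (Z #>\<^bsub>C\<^esub> a i) (Z #>\<^bsub>C\<^esub> b j)) - of_int (f (Z #>\<^bsub>C\<^esub> b j) (Z #>\<^bsub>C\<^esub> a i))
        = (if i = j then 1 else 0)"
      using comm(6) [OF C, of i j] by (simp flip: of_int_diff)
  qed (use C comm carrier_N in \<open>auto simp: algebra_simps\<close>)
qed

end

section \<open>A finitely generated group of permutations\<close>
lemma (in group) countable_generate:
  assumes "countable S" "S \<subseteq> carrier G"
  shows "countable (generate G S)"
proof -
  let ?W = "lists (S \<union> m_inv G ` S)"
  let ?prod = "\<lambda>ws. foldr (\<otimes>) ws \<one>"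
  have closed: "?prod ws \<in> carrier G" if "ws \<in> ?W" for ws
    using that assms(2) by (induction ws) auto
  have append: "?prod (vs @ ws) = ?prod vs \<otimes> ?prod ws" if "vs \<in> ?W" "ws \<in> ?W" for vs ws
    using that(1)
  proof (induction vs)
    case Nil
    then show ?case using closed [OF that(2)] by simp
  next
    case (Cons v vs)
    then have "v \<in> carrier G" "?prod vs \<in> carrier G"
      using closed assms(2) by auto
    then show ?case using Cons closed [OF that(2)] by (simp add: m_assoc)
  qed
  have "generate G S \<subseteq> ?prod ` ?W"
  proof
    fix g assume "g \<in> generate G S"
    then show "g \<in> ?prod ` ?W"
    proof (induction rule: generate.induct)
      case one
      show ?case by (rule image_eqI [of _ _ "[]"]) auto
    next
      case (incl h)
      then show ?case using assms(2) by (intro image_eqI [of _ _ "[h]"]) auto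
    next
      case (inv h)
      then show ?case using assms(2) by (intro image_eqI [of _ _ "[inv h]"]) auto
    next
      case (eng g h)
      then obtain vs ws where "vs \<in> ?W" "ws \<in> ?W" "g = ?prod vs" "h = ?prod ws"
        by blast
      then show ?case using append by (intro image_eqI [of _ _ "vs @ ws"]) auto
    qed
  qed
  moreover have "countable ?W"
    using assms(1) by (intro countable_lists) auto
  ultimately show ?thesis
    by (meson countable_image countable_subset)
qed

definition perm_group :: "('a \<Rightarrow> 'a) monoid" where
  "perm_group = \<lparr>carrier = {p. bij p}, monoid.mult = (\<circ>), one = id\<rparr>"

lemma perm_group_simps [simp]:
  "carrier perm_group = {p. bij p}" "p \<otimes>\<^bsub>perm_group\<^esub> q = p \<circ> q" "\<one>\<^bsub>perm_group\<^esub> = id"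
  by (simp_all add: perm_group_def)

lemma group_perm_group: "group perm_group"
proof (rule groupI)
  fix p :: "'a \<Rightarrow> 'a" assume "p \<in> carrier perm_group"
  then show "\<exists>q\<in>carrier perm_group. q \<otimes>\<^bsub>perm_group\<^esub> p = \<one>\<^bsub>perm_group\<^esub>"
    by (intro bexI [of _ "Hilbert_Choice.inv p"]) (simp_all add: bij_imp_bij_inv bij_is_inj)
qed (auto simp: bij_comp comp_assoc)

text \<open>
  A row of integer registers together with a counter.  The elements \<open>a\<^sub>i\<close>, \<open>b\<^sub>i\<close>, \<open>t\<close>, \<open>x\<close> are
  permutations of these states: adding register \<open>i\<close> to the counter, incrementing
  register \<open>i\<close>, shifting the row, and incrementing the counter.  Realizing the group by
  permutations makes the group laws automatic, and relations can be checked on states.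
\<close>
type_synonym state = "(int \<Rightarrow> int) \<times> int"

definition read_at :: "int \<Rightarrow> state \<Rightarrow> state" where
  "read_at i = (\<lambda>(q, c). (q, c + q i))"

definition incr_at :: "int \<Rightarrow> state \<Rightarrow> state" where
  "incr_at i = (\<lambda>(q, c). (q(i := q i + 1), c))"

definition shift_by :: "int \<Rightarrow> state \<Rightarrow> state" where
  "shift_by k = (\<lambda>(q, c). (\<lambda>i. q (i - k), c))"

definition count_up :: "state \<Rightarrow> state" where
  "count_up = (\<lambda>(q, c). (q, c + 1))"

lemma bij_state:
  "bij (read_at i)" "bij (incr_at i)" "bij (shift_by k)" "bij count_up"
proof -
  show "bij (read_at i)"
    by (rule o_bij [of "\<lambda>(q, c). (q, c - q i)"]) (auto simp: read_at_def)
  show "bij (incr_at i)"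
    by (rule o_bij [of "\<lambda>(q, c). (q(i := q i - 1), c)"]) (auto simp: incr_at_def)
  show "bij (shift_by k)"
    by (rule o_bij [of "shift_by (- k)"]) (auto simp: shift_by_def)
  show "bij count_up"
    by (rule o_bij [of "\<lambda>(q, c). (q, c - 1)"]) (auto simp: count_up_def)
qed

definition heisenberg_gens :: "(state \<Rightarrow> state) set" where
  "heisenberg_gens = {read_at 0, incr_at 0, shift_by 1}"

text \<open>
  As an abstract group this is the semidirect product of the Heisenberg group on the pairs
  \<open>a\<^sub>i, b\<^sub>i\<close>, \<open>i \<in> \<int>\<close>, with the shift.
\<close>
definition heisenberg_lamplighter :: "(state \<Rightarrow> state) monoid" where
  "heisenberg_lamplighter = perm_group\<lparr>carrier := generate perm_group heisenberg_gens\<rparr>"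

lemma heisenberg_gens_subset: "heisenberg_gens \<subseteq> carrier perm_group"
  by (simp add: heisenberg_gens_def bij_state)

lemma heisenberg_lamplighter_simps [simp]:
  "p \<otimes>\<^bsub>heisenberg_lamplighter\<^esub> q = p \<circ> q" "\<one>\<^bsub>heisenberg_lamplighter\<^esub> = id"
  by (simp_all add: heisenberg_lamplighter_def)

lemma subgroup_heisenberg: "subgroup (carrier heisenberg_lamplighter) perm_group"
  using group.generate_is_subgroup [OF group_perm_group heisenberg_gens_subset]
  by (simp add: heisenberg_lamplighter_def)

lemma group_heisenberg_lamplighter: "group heisenberg_lamplighter"
  using subgroup.subgroup_is_group [OF subgroup_heisenberg group_perm_group]
  by (simp add: heisenberg_lamplighter_def)

lemma finitely_generated_heisenberg_lamplighter:
  "finite heisenberg_gens" "heisenberg_gens \<subseteq> carrier heisenberg_lamplighter"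
  "generate heisenberg_lamplighter heisenberg_gens = carrier heisenberg_lamplighter"
proof -
  show "finite heisenberg_gens"
    by (simp add: heisenberg_gens_def)
  show gens: "heisenberg_gens \<subseteq> carrier heisenberg_lamplighter"
    by (auto simp: heisenberg_lamplighter_def intro: generate.incl)
  show "generate heisenberg_lamplighter heisenberg_gens = carrier heisenberg_lamplighter"
    using group.generate_consistent [OF group_perm_group gens subgroup_heisenberg]
    by (simp add: heisenberg_lamplighter_def)
qed

text \<open>
  Conjugation by the shift moves the generators to all indices, and the counter increment is the
  commutator of the two generators at index \<open>0\<close>.
\<close>
lemma heisenberg_lamplighter_mem:
  "read_at (int n) \<in> carrier heisenberg_lamplighter"
  "incr_at (int n) \<in> carrier heisenberg_lamplighter"
  "count_up \<in> carrier heisenberg_lamplighter"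
proof -
  let ?H = "carrier heisenberg_lamplighter"
  have inv: "q \<in> ?H" if "p \<in> ?H" "p \<circ> q = id" "q \<circ> p = id" for p q
  proof -
    have "inv\<^bsub>perm_group\<^esub> p = q"
      by (rule monoid.inv_char [OF group.is_monoid [OF group_perm_group]])
        (use that in \<open>auto intro: o_bij\<close>)
    then show ?thesis
      using subgroup.m_inv_closed [OF subgroup_heisenberg that(1)] by simp
  qed
  have comp: "p \<circ> q \<in> ?H" if "p \<in> ?H" "q \<in> ?H" for p q
    using subgroup.m_closed [OF subgroup_heisenberg that] by simp
  have gens: "read_at 0 \<in> ?H" "incr_at 0 \<in> ?H" "shift_by 1 \<in> ?H"
    using finitely_generated_heisenberg_lamplighter(2) by (auto simp: heisenberg_gens_def)
  have shift: "shift_by (- 1) \<in> ?H"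
    by (rule inv [OF gens(3)]) (auto simp: shift_by_def)
  have conj: "read_at (int (Suc n)) = shift_by 1 \<circ> read_at (int n) \<circ> shift_by (- 1)"
    "incr_at (int (Suc n)) = shift_by 1 \<circ> incr_at (int n) \<circ> shift_by (- 1)" for n
    by (auto simp: read_at_def incr_at_def shift_by_def fun_eq_iff algebra_simps)
  show "read_at (int n) \<in> ?H"
  proof (induction n)
    case (Suc n)
    then show ?case unfolding conj by (intro comp gens shift)
  qed (simp add: gens)
  show "incr_at (int n) \<in> ?H"
  proof (induction n)
    case (Suc n)
    then show ?case unfolding conj by (intro comp gens shift)
  qed (simp add: gens)
  have read_inv: "(\<lambda>(q, c). (q, c - q 0)) \<in> ?H"
    by (rule inv [OF gens(1)]) (auto simp: read_at_def fun_eq_iff)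
  have incr_inv: "(\<lambda>(q, c). (q(0 := q 0 - 1), c)) \<in> ?H"
    by (rule inv [OF gens(2)]) (auto simp: incr_at_def fun_eq_iff)
  have commutator: "count_up
      = read_at 0 \<circ> incr_at 0 \<circ> (\<lambda>(q, c). (q, c - q 0)) \<circ> (\<lambda>(q, c). (q(0 := q 0 - 1), c))"
    by (auto simp: count_up_def read_at_def incr_at_def fun_eq_iff)
  show "count_up \<in> ?H"
    unfolding commutator by (intro comp gens read_inv incr_inv)
qed

text \<open>
  Reading register \<open>i\<close> after incrementing it adds one more to the counter than reading it before.
\<close>
lemma heisenberg_relations:
  "read_at i \<circ> read_at j = read_at j \<circ> read_at i"
  "incr_at i \<circ> incr_at j = incr_at j \<circ> incr_at i"
  "read_at i \<circ> incr_at j = (if i = j then count_up else id) \<circ> (incr_at j \<circ> read_at i)"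
  "read_at i \<circ> count_up = count_up \<circ> read_at i"
  "incr_at i \<circ> count_up = count_up \<circ> incr_at i"
  by (auto simp: read_at_def incr_at_def count_up_def fun_eq_iff)

lemma infinite_order_count_up: "infinite_order heisenberg_lamplighter count_up"
proof -
  have "count_up [^]\<^bsub>heisenberg_lamplighter\<^esub> n = (\<lambda>(q, c). (q, c + int n))" for n
    by (induction n) (auto simp: nat_pow_def count_up_def fun_eq_iff)
  then show ?thesis
    by (auto simp: infinite_order_def fun_eq_iff)
qed

theorem theorem1p2:
  shows "\<exists>G :: nat monoid. finitely_generated_group G \<and> \<not> generalized_burghelea_conjecture G"
proof -
  let ?H = heisenberg_lamplighter
  have "countable (carrier ?H)"
    using group.countable_generate [OF group_perm_group _ heisenberg_gens_subset]
    by (simp add: heisenberg_lamplighter_def heisenberg_gens_def)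
  \<comment> \<open>A copy of the group on natural numbers.\<close>
  then obtain e :: "(state \<Rightarrow> state) \<Rightarrow> nat" where e: "inj_on e (carrier ?H)"
    by (rule countableE)
  define G where "G = image_group e ?H"
  interpret H: group ?H
    by (rule group_heisenberg_lamplighter)
  have iso: "e \<in> iso ?H G"
    unfolding G_def by (rule inj_imp_image_group_iso [OF e])
  have "group G"
    unfolding G_def by (rule H.inj_imp_image_group_is_group [OF e])
  then interpret e: group_hom ?H G e
    using iso by (simp add: group_hom_def group_hom_axioms_def iso_def H.group_axioms)
  have carrier_G: "carrier G = e ` carrier ?H"
    by (simp add: G_def image_group_carrier)
  have mult: "e p \<otimes>\<^bsub>G\<^esub> e q = e (p \<circ> q)" if "p \<in> carrier ?H" "q \<in> carrier ?H" for p q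
    using e.hom_mult [OF that] by simp
  note fg = finitely_generated_heisenberg_lamplighter
  have "finitely_generated_group G"
    unfolding finitely_generated_group_def
  proof (intro conjI exI [of _ "e ` heisenberg_gens"])
    show "generate G (e ` heisenberg_gens) = carrier G"
      using e.generate_img [OF fg(2)] fg(3) by (simp add: carrier_G)
  qed (use fg \<open>group G\<close> carrier_G in auto)
  moreover have "infinite_order G (e count_up)"
  proof -
    have "e (count_up [^]\<^bsub>?H\<^esub> n) \<noteq> \<one>\<^bsub>G\<^esub>" if "n \<noteq> 0" for n :: nat
      using inj_onD [OF e, of "count_up [^]\<^bsub>?H\<^esub> n" "\<one>\<^bsub>?H\<^esub>"] that infinite_order_count_up
        heisenberg_lamplighter_mem(3) by (auto simp: infinite_order_def simp del: heisenberg_lamplighter_simps)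
    then show ?thesis
      using heisenberg_lamplighter_mem(3) by (simp add: infinite_order_def e.hom_nat_pow)
  qed
  then interpret infinite_order_element G "e count_up"
    using \<open>group G\<close> heisenberg_lamplighter_mem(3)
    by (simp add: infinite_order_element_def infinite_order_element_axioms_def)
  have "\<one>\<^bsub>G\<^esub> = e id"
    using e.hom_one by simp
  then have "commuting_symplectic_sequences (reduced_centralizer G (e count_up))
      (\<lambda>A B. of_int (extension_cocycle G (e count_up) A B))
      (\<lambda>i. Z #>\<^bsub>C\<^esub> e (read_at (int i))) (\<lambda>i. Z #>\<^bsub>C\<^esub> e (incr_at (int i)))"
    using heisenberg_lamplighter_mem H.m_closed H.one_closed
    by (intro commuting_symplectic_sequences_in_N) (auto simp: mult heisenberg_relations)
  then have "carrier (burghelea_T G (e count_up) 0) \<noteq> {\<one>\<^bsub>burghelea_T G (e count_up) 0\<^esub>}"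
    by (rule burghelea_T_nontrivial)
  then have "\<not> generalized_burghelea_conjecture G"
    using x_closed infinite_order unfolding generalized_burghelea_conjecture_def by blast
  ultimately show ?thesis
    by blast
qed

end
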